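(* Let $a_0,\dots,a_7,b_0,\dots,b_7$ be real numbers and let $M$ be an $n$-dimensional $(\mathcal{T}_a,S_{\mathcal{T}_b})$-semisymmetric $(N(k),\xi)$-semi-Riemannian manifold. Then for all vector fields $Y,U$, $$\begin{aligned} 0&=\varepsilon a_5(b_0+nb_1+b_2+b_3+b_5+b_6)S^2(Y,U)\\ &\quad+\bigl\{\varepsilon(b_0+nb_1+b_2+b_3+b_5+b_6)(-ka_0+k(n-1)a_1+k(n-1)a_2-a_7r)+\varepsilon(a_1+a_5)(b_4r+(n-1)b_7r)\bigr\}S(Y,U)\\ &\quad+\bigl\{\varepsilon k(n-1)(a_2+a_4)(b_4r+(n-1)b_7r)+\varepsilon k(n-1)(b_0+nb_1+b_2+b_3+b_5+b_6)(ka_0+k(n-1)a_4+a_7r)\bigr\}g(Y,U)\\ &\quad+k(n-1)(a_1+a_2+2a_3+a_4+a_5+2a_6)\bigl\{(b_4r+(n-1)b_7r)+k(n-1)(b_0+nb_1+b_2+b_3+b_5+b_6)\bigr\}\eta(Y)\eta(U). \end{aligned}$$ In particular, if $M$ is a $(\mathcal{T}_a,S_{\mathcal{T}_a})$-semisymmetric $(N(k),\xi)$-semi-Riemannian manifold, then $$\begin{aligned} 0&=\varepsilon a_5(a_0+na_1+a_2+a_3+a_5+a_6)S^2(Y,U)\\ &\quad+\bigl\{\varepsilon(a_0+na_1+a_2+a_3+a_5+a_6)(-ka_0+k(n-1)a_1+k(n-1)a_2-a_7r)+\varepsilon(a_1+a_5)(a_4r+(n-1)a_7r)\bigr\}S(Y,U)\\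 &\quad+\bigl\{\varepsilon k(n-1)(a_2+a_4)(a_4r+(n-1)a_7r)+\varepsilon k(n-1)(a_0+na_1+a_2+a_3+a_5+a_6)(ka_0+k(n-1)a_4+a_7r)\bigr\}g(Y,U)\\ &\quad+k(n-1)(a_1+a_2+2a_3+a_4+a_5+2a_6)\bigl\{(a_4r+(n-1)a_7r)+k(n-1)(a_0+na_1+a_2+a_3+a_5+a_6)\bigr\}\eta(Y)\eta(U). \end{aligned}$$
   Context: Let $(M,g)$ be an $n$-dimensional semi-Riemannian manifold with curvature tensor $R$, Ricci tensor $S$ (with $S(Y,Z)$ the trace of $X\mapsto R(X,Y)Z$), Ricci operator $Q$ ($g(QX,Y)=S(X,Y)$) and scalar curvature $r$; $S^2(X,Y)=S(QX,Y)$. For real numbers $a_0,\dots,a_7$, the $\mathcal{T}_a$-curvature tensor is $$\mathcal{T}_a(X,Y)Z=a_0R(X,Y)Z+a_1S(Y,Z)X+a_2S(X,Z)Y+a_3S(X,Y)Z+a_4g(Y,Z)QX+a_5g(X,Z)QY+a_6g(X,Y)QZ+a_7r\,(g(Y,Z)X-g(X,Z)Y),$$ and $\mathcal{T}_b$ is the same with $a_i$ replaced by $b_i$. Its Ricci-type contraction is $$S_{\mathcal{T}_a}(X,Y)=(a_0+na_1+a_2+a_3+a_5+a_6)S(X,Y)+(a_4+(n-1)a_7)r\,g(X,Y),$$ and similarly $S_{\mathcal{T}_b}$. For a real number $k$, the $k$-nullity distribution is $N(k):p\mapsto\{Z\in T_pM: R(X,Y)Z=k(g(Y,Z)X-g(X,Z)Y)\text{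 for all }X,Y\in T_pM\}$. An $(N(k),\xi)$-semi-Riemannian manifold is a semi-Riemannian manifold with a non-null unit vector field $\xi$ belonging to $N(k)$; $g(\xi,\xi)=\varepsilon=\pm1$ and $\eta(X)=\varepsilon g(X,\xi)$. $M$ is $(\mathcal{T}_a,S_{\mathcal{T}_b})$-semisymmetric if $\mathcal{T}_a(X,Y)\cdot S_{\mathcal{T}_b}=0$ for all $X,Y$, i.e. $S_{\mathcal{T}_b}(\mathcal{T}_a(X,Y)U,V)+S_{\mathcal{T}_b}(U,\mathcal{T}_a(X,Y)V)=0$ for all $X,Y,U,V$. *)

theory Defs
  imports "HOL-Analysis.Analysis"
begin

section \<open>Smooth maps between Euclidean spaces\<close>

text \<open>Meant for open sets only: the derivatives are taken in the full neighbourhood of a point.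
  In finite dimension, all iterated directional derivatives existing and being continuous is the
  usual notion of being \<open>k\<close> times continuously differentiable.\<close>

primrec Ck_on :: "nat \<Rightarrow> ('a::euclidean_space) set \<Rightarrow> ('a \<Rightarrow> 'b::real_normed_vector) \<Rightarrow> bool" where
  "Ck_on 0 D f \<longleftrightarrow> continuous_on D f"
| "Ck_on (Suc k) D f \<longleftrightarrow>
     (\<forall>x\<in>D. f differentiable (at x)) \<and> (\<forall>v. Ck_on k D (\<lambda>x. frechet_derivative f (at x) v))"

definition smooth_on :: "('a::euclidean_space) set \<Rightarrow> ('a \<Rightarrow> 'b::real_normed_vector) \<Rightarrow> bool" where
  "smooth_on D f \<longleftrightarrow> (\<forall>k. Ck_on k D f)"


section \<open>Smooth manifolds\<close>

text \<open>The underlying set of a manifold is the whole type \<open>'m\<close>, its dimension is \<open>CARD('n)\<close>.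
  A chart is a pair of its domain and its coordinate map (whose values outside the domain are
  irrelevant). Besides an atlas, a manifold carries for every point a preferred chart around it;
  this is no restriction and serves to identify every tangent space with \<open>real ^ 'n\<close>:
  \<open>v :: real ^ 'n\<close>, regarded as a tangent vector at \<open>p\<close>, is the vector whose components in the
  chart \<open>chart_at M p\<close> are those of \<open>v\<close>. The field \<open>metric_at\<close> is a \<open>(0,2)\<close>-tensor at every
  point.\<close>

type_synonym ('m, 'n) chart = "'m set \<times> ('m \<Rightarrow> real ^ 'n)"

record ('m, 'n::finite) metric_manifold =
  atlas :: "('m, 'n) chart set"
  chart_at :: "'m \<Rightarrow> ('m, 'n) chart"
  metric_at :: "'m \<Rightarrow> real ^ 'n \<Rightarrow> real ^ 'n \<Rightarrow> real"

definition chart_dom :: "('m, 'n::finite) chart \<Rightarrow> 'm set" where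
  "chart_dom c = fst c"

definition chart_map :: "('m, 'n::finite) chart \<Rightarrow> 'm \<Rightarrow> real ^ 'n" where
  "chart_map c = snd c"

definition chart_image :: "('m, 'n::finite) chart \<Rightarrow> (real ^ 'n) set" where
  "chart_image c = chart_map c ` chart_dom c"

definition chart_inv :: "('m, 'n::finite) chart \<Rightarrow> real ^ 'n \<Rightarrow> 'm" where
  "chart_inv c = inv_into (chart_dom c) (chart_map c)"

definition is_chart :: "('m::topological_space, 'n::finite) chart \<Rightarrow> bool" where
  "is_chart c \<longleftrightarrow> open (chart_dom c) \<and> open (chart_image c) \<and>
     homeomorphism (chart_dom c) (chart_image c) (chart_map c) (chart_inv c)"

definition smooth_manifold ::
  "('m::{t2_space,second_countable_topology}, 'n::finite, 'z) metric_manifold_scheme \<Rightarrow> bool" where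
  "smooth_manifold M \<longleftrightarrow>
     (\<forall>c\<in>atlas M. is_chart c) \<and>
     (\<forall>c\<in>atlas M. \<forall>d\<in>atlas M.
        smooth_on (chart_map c ` (chart_dom c \<inter> chart_dom d)) (chart_map d \<circ> chart_inv c)) \<and>
     (\<forall>p. chart_at M p \<in> atlas M \<and> p \<in> chart_dom (chart_at M p))"

text \<open>The components in the chart \<open>d\<close> of the tangent vector at \<open>p\<close> with components \<open>v\<close> in the
  chart \<open>c\<close>.\<close>

definition coord_change ::
  "('m, 'n::finite) chart \<Rightarrow> ('m, 'n) chart \<Rightarrow> 'm \<Rightarrow> real ^ 'n \<Rightarrow> real ^ 'n" where
  "coord_change c d p v = frechet_derivative (chart_map d \<circ> chart_inv c) (at (chart_map c p)) v"

text \<open>The components of a vector field and of the metric in a chart \<open>c\<close>, as functions of the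
  coordinates.\<close>

definition local_field ::
  "('m, 'n::finite, 'z) metric_manifold_scheme \<Rightarrow> ('m, 'n) chart \<Rightarrow> ('m \<Rightarrow> real ^ 'n) \<Rightarrow>
     real ^ 'n \<Rightarrow> real ^ 'n" where
  "local_field M c X x = (let p = chart_inv c x in coord_change (chart_at M p) c p (X p))"

definition local_metric ::
  "('m, 'n::finite, 'z) metric_manifold_scheme \<Rightarrow> ('m, 'n) chart \<Rightarrow> real ^ 'n \<Rightarrow> real ^ 'n ^ 'n" where
  "local_metric M c x = (let p = chart_inv c x; J = coord_change c (chart_at M p) p in
     (\<chi> i j. metric_at M p (J (axis i 1)) (J (axis j 1))))"

definition vector_field ::
  "('m, 'n::finite, 'z) metric_manifold_scheme \<Rightarrow> ('m \<Rightarrow> real ^ 'n) \<Rightarrow> bool" where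
  "vector_field M X \<longleftrightarrow> (\<forall>c\<in>atlas M. smooth_on (chart_image c) (local_field M c X))"


section \<open>Semi-Riemannian manifolds\<close>

definition form_index :: "(real ^ 'n \<Rightarrow> real ^ 'n \<Rightarrow> real) \<Rightarrow> nat" where
  "form_index b = Max {dim V |V. subspace V \<and> (\<forall>v\<in>V. v \<noteq> 0 \<longrightarrow> b v v < 0)}"

definition semi_riemannian_manifold ::
  "('m::{t2_space,second_countable_topology}, 'n::finite, 'z) metric_manifold_scheme \<Rightarrow> bool" where
  "semi_riemannian_manifold M \<longleftrightarrow>
     smooth_manifold M \<and>
     (\<forall>p. bilinear (metric_at M p)) \<and>
     (\<forall>p v w. metric_at M p v w = metric_at M p w v) \<and>
     (\<forall>p v. (\<forall>w. metric_at M p v w = 0) \<longrightarrow> v = 0) \<and>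
     (\<exists>\<nu>. \<forall>p. form_index (metric_at M p) = \<nu>) \<and>
     (\<forall>c\<in>atlas M. \<forall>i j. smooth_on (chart_image c) (\<lambda>x. local_metric M c x $ i $ j))"


section \<open>Levi-Civita connection and curvature\<close>

definition partial_deriv :: "'n::finite \<Rightarrow> (real ^ 'n \<Rightarrow> real) \<Rightarrow> real ^ 'n \<Rightarrow> real" where
  "partial_deriv i f x = frechet_derivative f (at x) (axis i 1)"

text \<open>\<open>christoffel M c k i j\<close> is the Christoffel symbol of the second kind with upper index \<open>k\<close>
  and lower indices \<open>i\<close>, \<open>j\<close>.\<close>

definition christoffel ::
  "('m, 'n::finite, 'z) metric_manifold_scheme \<Rightarrow> ('m, 'n) chart \<Rightarrow> 'n \<Rightarrow> 'n \<Rightarrow> 'n \<Rightarrow>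
     real ^ 'n \<Rightarrow> real" where
  "christoffel M c k i j x = (\<Sum>l\<in>UNIV. 1/2 * matrix_inv (local_metric M c x) $ k $ l *
      (partial_deriv i (\<lambda>x. local_metric M c x $ j $ l) x
     + partial_deriv j (\<lambda>x. local_metric M c x $ i $ l) x
     - partial_deriv l (\<lambda>x. local_metric M c x $ i $ j) x))"

text \<open>Vector fields on a coordinate domain are represented by their components as functions of
  the coordinates.\<close>

definition levi_civita ::
  "('m, 'n::finite, 'z) metric_manifold_scheme \<Rightarrow> ('m, 'n) chart \<Rightarrow>
     (real ^ 'n \<Rightarrow> real ^ 'n) \<Rightarrow> (real ^ 'n \<Rightarrow> real ^ 'n) \<Rightarrow> real ^ 'n \<Rightarrow> real ^ 'n" where
  "levi_civita M c V W x = frechet_derivative W (at x) (V x) +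
     (\<chi> k. \<Sum>i\<in>UNIV. \<Sum>j\<in>UNIV. christoffel M c k i j x * V x $ i * W x $ j)"

definition lie_bracket ::
  "(real ^ 'n \<Rightarrow> real ^ 'n) \<Rightarrow> (real ^ 'n \<Rightarrow> real ^ 'n) \<Rightarrow> real ^ 'n \<Rightarrow> real ^ 'n::finite" where
  "lie_bracket V W x = frechet_derivative W (at x) (V x) - frechet_derivative V (at x) (W x)"

definition local_curvature ::
  "('m, 'n::finite, 'z) metric_manifold_scheme \<Rightarrow> ('m, 'n) chart \<Rightarrow>
     (real ^ 'n \<Rightarrow> real ^ 'n) \<Rightarrow> (real ^ 'n \<Rightarrow> real ^ 'n) \<Rightarrow> (real ^ 'n \<Rightarrow> real ^ 'n) \<Rightarrow>
     real ^ 'n \<Rightarrow> real ^ 'n" where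
  "local_curvature M c V W Z x =
     levi_civita M c V (levi_civita M c W Z) x
   - levi_civita M c W (levi_civita M c V Z) x
   - levi_civita M c (lie_bracket V W) Z x"

text \<open>The value of the curvature tensor on tangent vectors at \<open>p\<close>. By tensoriality any extension
  of the vectors to local vector fields may be used; here their components in \<open>chart_at M p\<close> are
  kept constant. The argument order is \<open>R(x,y)z\<close>.\<close>

definition curvature ::
  "('m, 'n::finite, 'z) metric_manifold_scheme \<Rightarrow> 'm \<Rightarrow>
     real ^ 'n \<Rightarrow> real ^ 'n \<Rightarrow> real ^ 'n \<Rightarrow> real ^ 'n" where
  "curvature M p x y z = (let c = chart_at M p in
     local_curvature M c (\<lambda>_. x) (\<lambda>_. y) (\<lambda>_. z) (chart_map c p))"

definition ricci ::
  "('m, 'n::finite, 'z) metric_manifold_scheme \<Rightarrow> 'm \<Rightarrow> real ^ 'n \<Rightarrow> real ^ 'n \<Rightarrow> real" where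
  "ricci M p y z = trace (matrix (\<lambda>x. curvature M p x y z))"

definition ricci_op ::
  "('m, 'n::finite, 'z) metric_manifold_scheme \<Rightarrow> 'm \<Rightarrow> real ^ 'n \<Rightarrow> real ^ 'n" where
  "ricci_op M p x = (THE v. \<forall>y. metric_at M p v y = ricci M p x y)"

definition ricci_sq ::
  "('m, 'n::finite, 'z) metric_manifold_scheme \<Rightarrow> 'm \<Rightarrow> real ^ 'n \<Rightarrow> real ^ 'n \<Rightarrow> real" where
  "ricci_sq M p x y = ricci M p (ricci_op M p x) y"

definition scalar_curvature ::
  "('m, 'n::finite, 'z) metric_manifold_scheme \<Rightarrow> 'm \<Rightarrow> real" where
  "scalar_curvature M p = trace (matrix (ricci_op M p))"


section \<open>The \<open>\<T>\<close>-curvature tensor and semisymmetry\<close>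

text \<open>The eight coefficients are \<open>a 0, \<dots>, a 7\<close>; other values of \<open>a\<close> are never used.\<close>

definition T_curvature ::
  "('m, 'n::finite, 'z) metric_manifold_scheme \<Rightarrow> (nat \<Rightarrow> real) \<Rightarrow> 'm \<Rightarrow>
     real ^ 'n \<Rightarrow> real ^ 'n \<Rightarrow> real ^ 'n \<Rightarrow> real ^ 'n" where
  "T_curvature M a p x y z =
     (let g = metric_at M p; S = ricci M p; Q = ricci_op M p; r = scalar_curvature M p in
        a 0 *\<^sub>R curvature M p x y z
      + (a 1 * S y z) *\<^sub>R x + (a 2 * S x z) *\<^sub>R y + (a 3 * S x y) *\<^sub>R z
      + (a 4 * g y z) *\<^sub>R Q x + (a 5 * g x z) *\<^sub>R Q y + (a 6 * g x y) *\<^sub>R Q z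
      + (a 7 * r) *\<^sub>R (g y z *\<^sub>R x - g x z *\<^sub>R y))"

definition T_ricci ::
  "('m, 'n::finite, 'z) metric_manifold_scheme \<Rightarrow> (nat \<Rightarrow> real) \<Rightarrow> 'm \<Rightarrow>
     real ^ 'n \<Rightarrow> real ^ 'n \<Rightarrow> real" where
  "T_ricci M a p x y =
     (let n = real CARD('n) in
        (a 0 + n * a 1 + a 2 + a 3 + a 5 + a 6) * ricci M p x y
      + (a 4 + (n - 1) * a 7) * scalar_curvature M p * metric_at M p x y)"

definition T_semisymmetric ::
  "('m, 'n::finite, 'z) metric_manifold_scheme \<Rightarrow> (nat \<Rightarrow> real) \<Rightarrow> (nat \<Rightarrow> real) \<Rightarrow> bool" where
  "T_semisymmetric M a b \<longleftrightarrow>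
     (\<forall>X Y U V. vector_field M X \<longrightarrow> vector_field M Y \<longrightarrow> vector_field M U \<longrightarrow> vector_field M V \<longrightarrow>
        (\<forall>p. T_ricci M b p (T_curvature M a p (X p) (Y p) (U p)) (V p)
           + T_ricci M b p (U p) (T_curvature M a p (X p) (Y p) (V p)) = 0))"


section \<open>\<open>(N(k),\<xi>)\<close>-semi-Riemannian manifolds\<close>

definition nullity :: "('m, 'n::finite, 'z) metric_manifold_scheme \<Rightarrow> real \<Rightarrow> 'm \<Rightarrow> (real ^ 'n) set" where
  "nullity M k p = {z. \<forall>x y. curvature M p x y z =
     k *\<^sub>R (metric_at M p y z *\<^sub>R x - metric_at M p x z *\<^sub>R y)}"

definition Nk_semi_riemannian_manifold ::
  "('m::{t2_space,second_countable_topology}, 'n::finite, 'z) metric_manifold_scheme \<Rightarrow> real \<Rightarrow>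
     ('m \<Rightarrow> real ^ 'n) \<Rightarrow> real \<Rightarrow> bool" where
  "Nk_semi_riemannian_manifold M k \<xi> \<epsilon> \<longleftrightarrow>
     semi_riemannian_manifold M \<and> vector_field M \<xi> \<and>
     (\<epsilon> = 1 \<or> \<epsilon> = -1) \<and> (\<forall>p. metric_at M p (\<xi> p) (\<xi> p) = \<epsilon>) \<and>
     (\<forall>p. \<xi> p \<in> nullity M k p)"

definition eta_form ::
  "('m, 'n::finite, 'z) metric_manifold_scheme \<Rightarrow> ('m \<Rightarrow> real ^ 'n) \<Rightarrow> real \<Rightarrow> 'm \<Rightarrow>
     real ^ 'n \<Rightarrow> real" where
  "eta_form M \<xi> \<epsilon> p x = \<epsilon> * metric_at M p x (\<xi> p)"

end

theory Submission
  imports Defs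
begin

text \<open>
  Evaluate the semisymmetry condition at \<open>X = V = \<xi>\<close>, that is
  \<open>S\<^sub>b(T\<^sub>a(\<xi>,Y)U, \<xi>) + S\<^sub>b(U, T\<^sub>a(\<xi>,Y)\<xi>) = 0\<close>, where \<open>S\<^sub>b = B S + C g\<close> with
  \<open>B = b\<^sub>0 + n b\<^sub>1 + b\<^sub>2 + b\<^sub>3 + b\<^sub>5 + b\<^sub>6\<close> and \<open>C = b\<^sub>4 r + (n - 1) b\<^sub>7 r\<close>. Since \<open>\<xi>\<close> lies in the
  nullity distribution, \<open>R(\<xi>,Y)\<xi> = k (g(Y,\<xi>) \<xi> - \<epsilon> Y)\<close>, and taking a trace gives
  \<open>S(Y,\<xi>) = k (n - 1) g(Y,\<xi>)\<close>. Together with \<open>g(R(\<xi>,Y)U, \<xi>) = - g(U, R(\<xi>,Y)\<xi>)\<close> and the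
  symmetry of \<open>S\<close> this turns every term into a multiple of \<open>S\<^sup>2(Y,U)\<close>, \<open>S(Y,U)\<close>, \<open>g(Y,U)\<close>
  or \<open>\<eta>(Y) \<eta>(U)\<close>, and collecting coefficients gives the claim. This computation is
  \<open>T_semisymmetric_identity\<close>; the second half of the theorem is its case \<open>b = a\<close>.

  Most of the work is to derive the symmetries of \<open>R\<close> and \<open>S\<close> from the coordinate expression
  of the curvature. In a chart, with the connection written as a vector-valued bilinear form
  \<open>\<Gamma>\<close>, one has
  \<open>R(u,v)w = \<partial>\<^sub>u \<Gamma>(v,w) - \<partial>\<^sub>v \<Gamma>(u,w) + \<Gamma>(u,\<Gamma>(v,w)) - \<Gamma>(v,\<Gamma>(u,w))\<close>. The first Bianchi identity
  is immediate from \<open>\<Gamma>(v,w) = \<Gamma>(w,v)\<close>. Skewness of \<open>R(u,v)\<close> with respect to \<open>g\<close> follows by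
  differentiating \<open>\<partial>\<^sub>v g(w,z) = g(\<Gamma>(v,w),z) + g(w,\<Gamma>(v,z))\<close> along \<open>u\<close> and antisymmetrising,
  because mixed second derivatives of \<open>g\<close> commute. Finally \<open>S(y,z) - S(z,y)\<close> is minus the trace of
  the skew map \<open>R(y,z)\<close>, hence zero.
\<close>

section \<open>Equality of mixed second derivatives\<close>

lemma frechet_derivative_along_line:
  fixes f :: "'a::real_normed_vector \<Rightarrow> real"
  assumes "f differentiable (at (p + t *\<^sub>R w))"
  shows "((\<lambda>s. f (p + s *\<^sub>R w)) has_real_derivative frechet_derivative f (at (p + t *\<^sub>R w)) w) (at t)"
proof -
  let ?f' = "frechet_derivative f (at (p + t *\<^sub>R w))"
  have f: "(f has_derivative ?f') (at (p + t *\<^sub>R w))"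
    using assms frechet_derivative_works by blast
  have "((\<lambda>s. p + s *\<^sub>R w) has_derivative (\<lambda>s. s *\<^sub>R w)) (at t)"
    by (auto intro!: derivative_eq_intros)
  from has_derivative_compose[OF this f]
  have "((\<lambda>s. f (p + s *\<^sub>R w)) has_derivative (\<lambda>s. ?f' (s *\<^sub>R w))) (at t)" .
  moreover have "(\<lambda>s. ?f' (s *\<^sub>R w)) = (*) (?f' w)"
    using has_derivative_linear[OF f] by (auto simp: linear_cmul mult.commute)
  ultimately show ?thesis
    by (simp add: has_field_derivative_def)
qed

text \<open>The mean value theorem, first along \<open>u\<close> and then along \<open>v\<close>.\<close>

lemma second_difference_mean_value:
  fixes f :: "'a::real_normed_vector \<Rightarrow> real"
  assumes h: "0 < h"
    and D: "\<And>s t. 0 \<le> s \<Longrightarrow> s \<le> h \<Longrightarrow> 0 \<le> t \<Longrightarrow> t \<le> h \<Longrightarrow> x + s *\<^sub>R u + t *\<^sub>R v \<in> D"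
    and f: "\<And>y. y \<in> D \<Longrightarrow> f differentiable (at y)"
    and fu: "\<And>y. y \<in> D \<Longrightarrow> (\<lambda>y. frechet_derivative f (at y) u) differentiable (at y)"
  obtains s t where "0 < s" "s < h" "0 < t" "t < h"
    "f (x + h *\<^sub>R u + h *\<^sub>R v) - f (x + h *\<^sub>R u) - f (x + h *\<^sub>R v) + f x
      = h * (h * frechet_derivative (\<lambda>y. frechet_derivative f (at y) u) (at (x + s *\<^sub>R u + t *\<^sub>R v)) v)"
proof -
  let ?fu = "\<lambda>y. frechet_derivative f (at y) u"
  have "((\<lambda>s. f ((x + h *\<^sub>R v) + s *\<^sub>R u) - f (x + s *\<^sub>R u)) has_real_derivative
           ?fu ((x + h *\<^sub>R v) + s *\<^sub>R u) - ?fu (x + s *\<^sub>R u)) (at s)" if "0 \<le> s" "s \<le> h" for s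
    using D[of s 0] D[of s h] that h
    by (intro DERIV_diff frechet_derivative_along_line f) (auto simp: algebra_simps)
  from MVT2[OF h this] obtain s where s: "0 < s" "s < h" and
    1: "f ((x + h *\<^sub>R v) + h *\<^sub>R u) - f (x + h *\<^sub>R u) - (f (x + h *\<^sub>R v) - f x)
      = h * (?fu ((x + h *\<^sub>R v) + s *\<^sub>R u) - ?fu (x + s *\<^sub>R u))"
    by auto
  have "((\<lambda>t. ?fu ((x + s *\<^sub>R u) + t *\<^sub>R v)) has_real_derivative
           frechet_derivative ?fu (at ((x + s *\<^sub>R u) + t *\<^sub>R v)) v) (at t)" if "0 \<le> t" "t \<le> h" for t
    using D[of s t] that s by (intro frechet_derivative_along_line fu) auto
  from MVT2[OF h this] obtain t where t: "0 < t" "t < h" and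
    2: "?fu ((x + s *\<^sub>R u) + h *\<^sub>R v) - ?fu (x + s *\<^sub>R u)
      = h * frechet_derivative ?fu (at ((x + s *\<^sub>R u) + t *\<^sub>R v)) v"
    by auto
  show ?thesis
    by (rule that[OF s t]) (use 1 2 in \<open>simp add: algebra_simps\<close>)
qed

text \<open>Both mixed derivatives are limits of the same second difference quotient.\<close>

lemma mixed_derivatives_commute:
  fixes f :: "'a::real_normed_vector \<Rightarrow> real"
  defines "fd \<equiv> \<lambda>w y. frechet_derivative f (at y) w"
  assumes D: "open D" "x \<in> D"
    and f: "\<And>y. y \<in> D \<Longrightarrow> f differentiable (at y)"
    and fd: "\<And>w y. y \<in> D \<Longrightarrow> fd w differentiable (at y)"
    and cont: "\<And>w z. continuous_on D (\<lambda>y. frechet_derivative (fd w) (at y) z)"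
  shows "frechet_derivative (fd u) (at x) v = frechet_derivative (fd v) (at x) u"
proof -
  let ?P = "\<lambda>y. frechet_derivative (fd u) (at y) v"
  let ?Q = "\<lambda>y. frechet_derivative (fd v) (at y) u"
  have "\<bar>?P x - ?Q x\<bar> \<le> 0 + e" if "e > 0" for e
  proof -
    have near: "\<exists>d>0. \<forall>y. dist y x < d \<longrightarrow> y \<in> D \<and> \<bar>g y - g x\<bar> < e / 2"
      if "continuous_on D g" for g :: "'a \<Rightarrow> real"
    proof -
      have "isCont g x" using that D continuous_on_eq_continuous_at by blast
      then obtain d1 where "d1 > 0" "\<forall>y. dist y x < d1 \<longrightarrow> dist (g y) (g x) < e / 2"
        unfolding continuous_at_eps_delta using \<open>e > 0\<close> by (meson half_gt_zero)
      moreover obtain d2 where "d2 > 0" "ball x d2 \<subseteq> D"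
        using D openE by blast
      ultimately show ?thesis
        by (intro exI[of _ "min d1 d2"]) (auto simp: dist_real_def dist_commute subset_iff)
    qed
    obtain d1 where d1: "d1 > 0" "\<And>y. dist y x < d1 \<Longrightarrow> y \<in> D \<and> \<bar>?P y - ?P x\<bar> < e / 2"
      using near[OF cont] by blast
    obtain d2 where d2: "d2 > 0" "\<And>y. dist y x < d2 \<Longrightarrow> y \<in> D \<and> \<bar>?Q y - ?Q x\<bar> < e / 2"
      using near[OF cont] by blast
    \<comment> \<open>The side \<open>h\<close> keeps the whole parallelogram spanned at \<open>x\<close> inside both neighbourhoods;
      the summand 1 avoids division by zero.\<close>
    define N where "N = 1 + norm u + norm v"
    define h where "h = min d1 d2 / (2 * N)"
    have N: "N > 0" unfolding N_def by (smt (verit) norm_ge_zero)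
    have h: "h > 0" unfolding h_def using N d1(1) d2(1) by simp
    have hN: "h * N < min d1 d2" unfolding h_def using N d1(1) d2(1) by (simp add: field_simps min_def)
    have small: "dist (x + s *\<^sub>R u + t *\<^sub>R v) x < min d1 d2"
      if "0 \<le> s" "s \<le> h" "0 \<le> t" "t \<le> h" for s t
    proof -
      have "dist (x + s *\<^sub>R u + t *\<^sub>R v) x = norm (s *\<^sub>R u + t *\<^sub>R v)"
        by (simp add: dist_norm algebra_simps)
      also have "\<dots> \<le> s * norm u + t * norm v"
        using norm_triangle_ineq[of "s *\<^sub>R u" "t *\<^sub>R v"] that by simp
      also have "\<dots> \<le> h * norm u + h * norm v"
        using that by (intro add_mono mult_right_mono) auto
      also have "\<dots> \<le> h * N" unfolding N_def using h by (simp add: algebra_simps)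
      finally show ?thesis using hN by simp
    qed
    then have inD: "x + s *\<^sub>R u + t *\<^sub>R v \<in> D"
      if "0 \<le> s" "s \<le> h" "0 \<le> t" "t \<le> h" for s t
      using d1(2) that by simp
    have inD': "x + s *\<^sub>R v + t *\<^sub>R u \<in> D"
      if "0 \<le> s" "s \<le> h" "0 \<le> t" "t \<le> h" for s t
      using inD[of t s] that by (simp add: algebra_simps)
    obtain s t where st: "0 < s" "s < h" "0 < t" "t < h" and
      1: "f (x + h *\<^sub>R u + h *\<^sub>R v) - f (x + h *\<^sub>R u) - f (x + h *\<^sub>R v) + f x
        = h * (h * ?P (x + s *\<^sub>R u + t *\<^sub>R v))"
      using second_difference_mean_value[where u = u and v = v, OF h inD f fd[unfolded fd_def]]
      unfolding fd_def by blast
    obtain s' t' where st': "0 < s'" "s' < h" "0 < t'" "t' < h" and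
      2: "f (x + h *\<^sub>R v + h *\<^sub>R u) - f (x + h *\<^sub>R v) - f (x + h *\<^sub>R u) + f x
        = h * (h * ?Q (x + s' *\<^sub>R v + t' *\<^sub>R u))"
      using second_difference_mean_value[where u = v and v = u, OF h inD' f fd[unfolded fd_def]]
      unfolding fd_def by blast
    have "h * (h * ?P (x + s *\<^sub>R u + t *\<^sub>R v)) = h * (h * ?Q (x + s' *\<^sub>R v + t' *\<^sub>R u))"
      using 1 2 by (simp add: algebra_simps)
    then have "?P (x + s *\<^sub>R u + t *\<^sub>R v) = ?Q (x + t' *\<^sub>R u + s' *\<^sub>R v)"
      using h by (simp add: algebra_simps)
    moreover have "\<bar>?P (x + s *\<^sub>R u + t *\<^sub>R v) - ?P x\<bar> < e / 2"
      using d1(2) small[of s t] st by simp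
    moreover have "\<bar>?Q (x + t' *\<^sub>R u + s' *\<^sub>R v) - ?Q x\<bar> < e / 2"
      using d2(2) small[of t' s'] st' by simp
    ultimately show ?thesis by linarith
  qed
  then have "\<bar>?P x - ?Q x\<bar> \<le> 0"
    by (rule field_le_epsilon)
  then show ?thesis by simp
qed


section \<open>The curvature tensor in a chart\<close>

lemma linear_axis_expansion:
  fixes h :: "real ^ 'n::finite \<Rightarrow> 'b::real_vector"
  assumes "linear h"
  shows "h v = (\<Sum>i\<in>UNIV. v $ i *\<^sub>R h (axis i 1))"
proof -
  have "h v = h (\<Sum>i\<in>UNIV. v $ i *\<^sub>R axis i 1)"
    by (simp add: basis_expansion scalar_mult_eq_scaleR[symmetric])
  then show ?thesis using assms by (simp add: linear_sum linear_cmul)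
qed

lemma bilinear_axis_expansion:
  fixes h :: "real ^ 'n::finite \<Rightarrow> real ^ 'n \<Rightarrow> real"
  assumes "bilinear h"
  shows "h v w = (\<Sum>i\<in>UNIV. \<Sum>j\<in>UNIV. v $ i * w $ j * h (axis i 1) (axis j 1))"
proof -
  have 1: "linear (\<lambda>v. h v w)" for w
    using assms by (simp add: bilinear_def)
  have 2: "linear (h v)" for v
    using assms by (simp add: bilinear_def)
  have "h v w = (\<Sum>i\<in>UNIV. v $ i * h (axis i 1) w)"
    using linear_axis_expansion[OF 1, of v w] by simp
  also have "\<dots> = (\<Sum>i\<in>UNIV. v $ i * (\<Sum>j\<in>UNIV. w $ j * h (axis i 1) (axis j 1)))"
    using linear_axis_expansion[OF 2] by (metis (no_types, lifting) real_scaleR_def sum.cong)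
  finally show ?thesis by (simp add: sum_distrib_left mult.assoc)
qed

lemma differentiable_prod_at:
  fixes f :: "'i \<Rightarrow> 'a::real_normed_vector \<Rightarrow> real"
  assumes "\<And>i. i \<in> I \<Longrightarrow> f i differentiable (at x)"
  shows "(\<lambda>y. \<Prod>i\<in>I. f i y) differentiable (at x)"
proof (cases "finite I")
  case True
  then show ?thesis using assms by (induction I) auto
qed auto

lemma differentiable_det:
  fixes A :: "'a::real_normed_vector \<Rightarrow> real ^ 'n ^ 'n"
  assumes "\<And>i j. (\<lambda>y. A y $ i $ j) differentiable (at x)"
  shows "(\<lambda>y. det (A y)) differentiable (at x)"
  unfolding det_def
  by (intro differentiable_sum ballI differentiable_mult differentiable_const differentiable_prod_at assms)
    (simp add: finite_permutations)

lemma matrix_inv_mult: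
  fixes A :: "'a::semiring_1 ^ 'n ^ 'n"
  assumes "invertible A"
  shows "A ** matrix_inv A = mat 1" "matrix_inv A ** A = mat 1"
  using someI_ex[of "\<lambda>B. A ** B = mat 1 \<and> B ** A = mat 1"] assms
  unfolding invertible_def matrix_inv_def by auto

text \<open>By Cramer's rule the entries of the inverse are quotients of determinants.\<close>

lemma matrix_inv_entry:
  fixes A :: "real ^ 'n ^ 'n"
  assumes "invertible A"
  shows "matrix_inv A $ k $ l = det (\<chi> i j. if j = k then axis l 1 $ i else A $ i $ j) / det A"
proof -
  have "A *v (matrix_inv A *v axis l 1) = axis l 1"
    using matrix_inv_mult[OF assms] by (simp add: matrix_vector_mul_assoc)
  then have "matrix_inv A *v axis l 1 =
      (\<chi> k. det (\<chi> i j. if j = k then axis l 1 $ i else A $ i $ j) / det A)"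
    using assms by (simp add: cramer invertible_det_nz)
  then have "(matrix_inv A *v axis l 1) $ k =
      det (\<chi> i j. if j = k then axis l 1 $ i else A $ i $ j) / det A"
    by simp
  moreover have "(matrix_inv A *v axis l 1) $ k = matrix_inv A $ k $ l"
    by (simp add: matrix_vector_mult_def axis_def if_distrib[of "\<lambda>x. _ * x"] cong: if_cong)
  ultimately show ?thesis by simp
qed

lemma differentiable_matrix_inv_entry:
  fixes A :: "'a::real_normed_vector \<Rightarrow> real ^ 'n ^ 'n"
  assumes "open D" "x \<in> D" and inv: "\<And>y. y \<in> D \<Longrightarrow> invertible (A y)"
    and A: "\<And>i j. (\<lambda>y. A y $ i $ j) differentiable (at x)"
  shows "(\<lambda>y. matrix_inv (A y) $ k $ l) differentiable (at x)"
proof -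
  have "(\<lambda>y. if j = k then axis l 1 $ i else A y $ i $ j) differentiable (at x)" for i j
    by (cases "j = k") (auto simp: A)
  then have "(\<lambda>y. det (\<chi> i j. if j = k then axis l 1 $ i else A y $ i $ j)) differentiable (at x)"
    by (intro differentiable_det) simp
  then have "(\<lambda>y. det (\<chi> i j. if j = k then axis l 1 $ i else A y $ i $ j) / det (A y))
      differentiable (at x)"
    using inv[OF \<open>x \<in> D\<close>] differentiable_det[OF A]
    by (intro differentiable_divide) (auto simp: invertible_det_nz)
  then show ?thesis
    using has_derivative_transform_within_open[OF _ assms(1,2)] matrix_inv_entry[OF inv]
    unfolding differentiable_def by (metis (no_types, lifting))
qed

lemma differentiable_vec_lambda:
  fixes f :: "'a::real_normed_vector \<Rightarrow> real ^ 'n"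
  assumes "\<And>i. (\<lambda>y. f y $ i) differentiable (at x)"
  shows "f differentiable (at x)"
  using assms
  by (subst differentiable_componentwise_within) (auto simp: Basis_vec_def inner_axis)

text \<open>A chart in whose coordinates the metric is a smooth field of symmetric invertible matrices.
  At the points of such a chart the curvature has its usual symmetries.\<close>

locale coordinate_metric =
  fixes M :: "('m, 'n::finite, 'z) metric_manifold_scheme" and c :: "('m, 'n) chart"
  assumes open_image: "open (chart_image c)"
    and metric_symmetric: "x \<in> chart_image c \<Longrightarrow> local_metric M c x $ i $ j = local_metric M c x $ j $ i"
    and metric_invertible: "x \<in> chart_image c \<Longrightarrow> invertible (local_metric M c x)"
    and metric_smooth: "smooth_on (chart_image c) (\<lambda>x. local_metric M c x $ i $ j)"
begin

abbreviation D :: "(real ^ 'n) set" where "D \<equiv> chart_image c"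

text \<open>The metric as a bilinear form in coordinates.\<close>

definition g :: "real ^ 'n \<Rightarrow> real ^ 'n \<Rightarrow> real ^ 'n \<Rightarrow> real" where
  "g x v w = v \<bullet> (local_metric M c x *v w)"

text \<open>\<open>dg x u v w\<close> is the derivative at \<open>x\<close> in the direction \<open>u\<close> of \<open>g(v,w)\<close>, for constant
  \<open>v\<close> and \<open>w\<close>.\<close>

definition dg :: "real ^ 'n \<Rightarrow> real ^ 'n \<Rightarrow> real ^ 'n \<Rightarrow> real ^ 'n \<Rightarrow> real" where
  "dg x u v w = frechet_derivative (\<lambda>y. g y v w) (at x) u"

text \<open>The Christoffel symbols as a vector-valued form: the covariant derivative along \<open>v\<close> of
  the vector field with constant components \<open>w\<close>.\<close>

definition \<Gamma> :: "real ^ 'n \<Rightarrow> real ^ 'n \<Rightarrow> real ^ 'n \<Rightarrow> real ^ 'n" where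
  "\<Gamma> x v w = (\<chi> k. \<Sum>i\<in>UNIV. \<Sum>j\<in>UNIV. christoffel M c k i j x * v $ i * w $ j)"

lemma entry_differentiable:
  assumes "x \<in> D" shows "(\<lambda>y. local_metric M c y $ i $ j) differentiable (at x)"
proof -
  have "Ck_on (Suc 0) D (\<lambda>y. local_metric M c y $ i $ j)"
    using metric_smooth unfolding smooth_on_def by blast
  then show ?thesis using assms by simp
qed

lemma entry_derivative_differentiable:
  assumes "x \<in> D"
  shows "(\<lambda>y. frechet_derivative (\<lambda>y. local_metric M c y $ i $ j) (at y) u) differentiable (at x)"
proof -
  have "Ck_on (Suc (Suc 0)) D (\<lambda>y. local_metric M c y $ i $ j)"
    using metric_smooth unfolding smooth_on_def by blast
  then show ?thesis using assms by simp
qed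

lemma entry_mixed_derivatives_commute:
  assumes "x \<in> D"
  shows "frechet_derivative (\<lambda>y. frechet_derivative (\<lambda>y. local_metric M c y $ i $ j) (at y) u) (at x) v
       = frechet_derivative (\<lambda>y. frechet_derivative (\<lambda>y. local_metric M c y $ i $ j) (at y) v) (at x) u"
proof (rule mixed_derivatives_commute[OF open_image assms])
  fix w z
  have "Ck_on (Suc (Suc 0)) D (\<lambda>y. local_metric M c y $ i $ j)"
    using metric_smooth unfolding smooth_on_def by blast
  then show "continuous_on D (\<lambda>y. frechet_derivative
      (\<lambda>y. frechet_derivative (\<lambda>y. local_metric M c y $ i $ j) (at y) w) (at y) z)"
    by simp
qed (simp_all add: entry_differentiable entry_derivative_differentiable)

lemma g_expand: "g x v w = (\<Sum>i\<in>UNIV. \<Sum>j\<in>UNIV. v $ i * w $ j * local_metric M c x $ i $ j)"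
  by (simp add: g_def inner_vec_def matrix_vector_mult_def sum_distrib_left mult_ac)

lemma bilinear_g: "bilinear (g x)"
  by (auto simp: bilinear_def linear_iff g_def inner_left_distrib inner_right_distrib
      matrix_vector_right_distrib matrix_vector_mult_scaleR)

lemmas g_simps =
  bilinear_ladd[OF bilinear_g] bilinear_radd[OF bilinear_g]
  bilinear_lsub[OF bilinear_g] bilinear_rsub[OF bilinear_g]
  bilinear_lmul[OF bilinear_g] bilinear_rmul[OF bilinear_g]

lemma g_sym: "x \<in> D \<Longrightarrow> g x v w = g x w v"
  unfolding g_expand by (subst sum.swap) (simp add: metric_symmetric mult_ac)

lemma g_has_derivative:
  assumes x: "x \<in> D" and V: "(V has_derivative V') (at x)"
  shows "((\<lambda>y. g y (V y) w) has_derivative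
     (\<lambda>u. g x (V' u) w + (\<Sum>i\<in>UNIV. \<Sum>j\<in>UNIV.
        V x $ i * w $ j * frechet_derivative (\<lambda>y. local_metric M c y $ i $ j) (at x) u))) (at x)"
proof -
  have V_i: "((\<lambda>y. V y $ i) has_derivative (\<lambda>u. V' u $ i)) (at x)" for i
    by (rule bounded_linear.has_derivative[OF bounded_linear_vec_nth V])
  have e: "((\<lambda>y. local_metric M c y $ i $ j) has_derivative
      frechet_derivative (\<lambda>y. local_metric M c y $ i $ j) (at x)) (at x)" for i j
    using entry_differentiable[OF x] frechet_derivative_works by blast
  have "((\<lambda>y. V y $ i * w $ j) has_derivative (\<lambda>u. V' u $ i * w $ j)) (at x)" for i j
    by (rule has_derivative_mult_left[OF V_i])
  from has_derivative_mult[OF this e] show ?thesis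
    unfolding g_expand sum.distrib[symmetric]
    by (auto intro!: has_derivative_sum simp: add.commute)
qed

lemma g_differentiable: "x \<in> D \<Longrightarrow> (\<lambda>y. g y v w) differentiable (at x)"
  using g_has_derivative[of x "\<lambda>_. v" "\<lambda>_. 0" w] unfolding differentiable_def
  using has_derivative_const by blast

lemma dg_expand:
  assumes "x \<in> D"
  shows "dg x u v w = (\<Sum>i\<in>UNIV. \<Sum>j\<in>UNIV.
    v $ i * w $ j * frechet_derivative (\<lambda>y. local_metric M c y $ i $ j) (at x) u)"
  unfolding dg_def
  using frechet_derivative_at[OF g_has_derivative[OF assms has_derivative_const, of v w], symmetric]
    bilinear_lzero[OF bilinear_g] by simp

lemma g_derivative:
  assumes "x \<in> D" "V differentiable (at x)"
  shows "frechet_derivative (\<lambda>y. g y (V y) w) (at x) u =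
    g x (frechet_derivative V (at x) u) w + dg x u (V x) w"
  using frechet_derivative_at[OF g_has_derivative[of x V "frechet_derivative V (at x)" w], symmetric]
    assms by (simp add: dg_expand frechet_derivative_works)

lemma dg_linear: "x \<in> D \<Longrightarrow> linear (\<lambda>u. dg x u v w)"
  unfolding dg_def using linear_frechet_derivative[OF g_differentiable] by (simp add: eta_contract_eq)

lemma bilinear_dg: "x \<in> D \<Longrightarrow> bilinear (dg x u)"
  by (auto simp: bilinear_def linear_iff dg_expand sum.distrib[symmetric] sum_distrib_left algebra_simps)

lemma dg_sym: "x \<in> D \<Longrightarrow> dg x u v w = dg x u w v"
  unfolding dg_def
  by (rule fun_cong, rule frechet_derivative_transform_within_open[OF g_differentiable open_image])
     (auto simp: g_sym)

lemma dg_axis: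
  assumes "x \<in> D"
  shows "dg x (axis l 1) (axis i 1) (axis j 1) = partial_deriv l (\<lambda>y. local_metric M c y $ i $ j) x"
proof -
  have "(\<lambda>y. g y (axis i 1) (axis j 1)) = (\<lambda>y. local_metric M c y $ i $ j)"
    by (rule ext) (simp add: g_def matrix_vector_mul_component inner_axis' matrix_vector_mult_basis column_def)
  then show ?thesis by (simp add: dg_def partial_deriv_def)
qed

lemma dg_differentiable:
  assumes "x \<in> D" shows "(\<lambda>y. dg y u v w) differentiable (at x)"
proof -
  have "(\<lambda>y. \<Sum>i\<in>UNIV. \<Sum>j\<in>UNIV.
      v $ i * w $ j * frechet_derivative (\<lambda>y. local_metric M c y $ i $ j) (at y) u) differentiable (at x)"
    by (intro differentiable_sum ballI differentiable_mult differentiable_const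
        entry_derivative_differentiable assms) simp_all
  then show ?thesis
    using has_derivative_transform_within_open[OF _ open_image assms] dg_expand
    unfolding differentiable_def by (metis (no_types, lifting))
qed

lemma dg_derivatives_commute:
  assumes "x \<in> D"
  shows "frechet_derivative (\<lambda>y. dg y u v w) (at x) u' = frechet_derivative (\<lambda>y. dg y u' v w) (at x) u"
proof -
  have "frechet_derivative (\<lambda>y. dg y u v w) (at x) u' = (\<Sum>i\<in>UNIV. \<Sum>j\<in>UNIV. v $ i * w $ j *
     frechet_derivative (\<lambda>y. frechet_derivative (\<lambda>y. local_metric M c y $ i $ j) (at y) u) (at x) u')"
    for u u'
  proof -
    have "((\<lambda>y. \<Sum>i\<in>UNIV. \<Sum>j\<in>UNIV.
        v $ i * w $ j * frechet_derivative (\<lambda>y. local_metric M c y $ i $ j) (at y) u)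
      has_derivative (\<lambda>u'. \<Sum>i\<in>UNIV. \<Sum>j\<in>UNIV. v $ i * w $ j *
        frechet_derivative (\<lambda>y. frechet_derivative (\<lambda>y. local_metric M c y $ i $ j) (at y) u) (at x) u'))
      (at x)"
      using entry_derivative_differentiable[OF assms, unfolded frechet_derivative_works]
      by (intro has_derivative_sum has_derivative_mult_right)
    then have "((\<lambda>y. dg y u v w)
      has_derivative (\<lambda>u'. \<Sum>i\<in>UNIV. \<Sum>j\<in>UNIV. v $ i * w $ j *
        frechet_derivative (\<lambda>y. frechet_derivative (\<lambda>y. local_metric M c y $ i $ j) (at y) u) (at x) u'))
      (at x)"
      by (rule has_derivative_transform_within_open[OF _ open_image assms]) (simp add: dg_expand)
    from frechet_derivative_at[OF this, symmetric] show ?thesis by simp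
  qed
  then show ?thesis using entry_mixed_derivatives_commute[OF assms] by simp
qed

text \<open>The right-hand side of the Koszul formula for fields with constant components, whose
  brackets vanish.\<close>

definition koszul :: "real ^ 'n \<Rightarrow> real ^ 'n \<Rightarrow> real ^ 'n \<Rightarrow> real ^ 'n \<Rightarrow> real" where
  "koszul x v w u = (dg x v w u + dg x w v u - dg x u v w) / 2"

lemma \<Gamma>_eq:
  assumes x: "x \<in> D"
  shows "\<Gamma> x v w = matrix_inv (local_metric M c x) *v (\<chi> l. koszul x v w (axis l 1))"
proof -
  note lin = dg_linear[OF x, unfolded linear_iff] bilinear_dg[OF x, unfolded bilinear_def linear_iff]
  have k: "koszul x v w u =
      (\<Sum>i\<in>UNIV. \<Sum>j\<in>UNIV. v $ i * w $ j * koszul x (axis i 1) (axis j 1) u)" for u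
    by (rule bilinear_axis_expansion)
      (use lin in \<open>auto simp: bilinear_def linear_iff koszul_def field_simps\<close>)
  have "christoffel M c k i j x =
      (\<Sum>l\<in>UNIV. matrix_inv (local_metric M c x) $ k $ l * koszul x (axis i 1) (axis j 1) (axis l 1))"
    for k i j
    unfolding christoffel_def koszul_def by (simp add: dg_axis[OF x] mult_ac)
  then have "\<Gamma> x v w $ k = (\<Sum>i\<in>UNIV. \<Sum>j\<in>UNIV. \<Sum>l\<in>UNIV.
     matrix_inv (local_metric M c x) $ k $ l * (v $ i * w $ j * koszul x (axis i 1) (axis j 1) (axis l 1)))"
    for k
    by (simp add: \<Gamma>_def sum_distrib_left sum_distrib_right mult_ac)
  also have "\<dots> k = (\<Sum>i\<in>UNIV. \<Sum>l\<in>UNIV. \<Sum>j\<in>UNIV.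
     matrix_inv (local_metric M c x) $ k $ l * (v $ i * w $ j * koszul x (axis i 1) (axis j 1) (axis l 1)))"
    for k
    by (intro sum.cong refl sum.swap)
  also have "\<dots> k = (\<Sum>l\<in>UNIV. \<Sum>i\<in>UNIV. \<Sum>j\<in>UNIV.
     matrix_inv (local_metric M c x) $ k $ l * (v $ i * w $ j * koszul x (axis i 1) (axis j 1) (axis l 1)))"
    for k
    by (rule sum.swap)
  finally show ?thesis
    by (subst k) (simp add: vec_eq_iff matrix_vector_mult_def sum_distrib_left)
qed

lemma koszul_formula:
  assumes x: "x \<in> D"
  shows "g x (\<Gamma> x v w) u = koszul x v w u"
proof -
  note lin = dg_linear[OF x, unfolded linear_iff] bilinear_dg[OF x, unfolded bilinear_def linear_iff]
  have "g x (\<Gamma> x v w) u = u \<bullet> (\<chi> l. koszul x v w (axis l 1))"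
    unfolding g_sym[OF x, of _ u] unfolding g_def \<Gamma>_eq[OF x]
    using matrix_inv_mult[OF metric_invertible[OF x]] by (simp add: matrix_vector_mul_assoc)
  also have "\<dots> = (\<Sum>l\<in>UNIV. u $ l *\<^sub>R koszul x v w (axis l 1))"
    by (simp add: inner_vec_def)
  also have "\<dots> = koszul x v w u"
    by (rule linear_axis_expansion[symmetric])
      (use lin in \<open>auto simp: linear_iff koszul_def field_simps\<close>)
  finally show ?thesis .
qed

lemma g_nondegenerate:
  assumes x: "x \<in> D" and "\<And>u. g x v u = g x w u" shows "v = w"
proof -
  have "u \<bullet> (local_metric M c x *v v) = u \<bullet> (local_metric M c x *v w)" for u
    using assms(2)[of u] unfolding g_sym[OF x, of _ u] by (simp add: g_def)
  then have "local_metric M c x *v v = local_metric M c x *v w"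
    using vector_eq_ldot by blast
  then show ?thesis
    using matrix_inv_mult(2)[OF metric_invertible[OF x]]
    by (metis matrix_vector_mul_assoc matrix_vector_mul_lid)
qed

text \<open>The connection is torsion-free.\<close>

lemma \<Gamma>_sym: "x \<in> D \<Longrightarrow> \<Gamma> x v w = \<Gamma> x w v"
  by (rule g_nondegenerate) (auto simp: koszul_formula koszul_def dg_sym[of x _ v w])

lemma metric_compatible:
  assumes "x \<in> D" shows "dg x u v w = g x (\<Gamma> x u v) w + g x v (\<Gamma> x u w)"
  using assms dg_sym[OF assms]
  by (simp add: g_sym[of x v] koszul_formula koszul_def field_simps)

lemma bilinear_\<Gamma>: "bilinear (\<Gamma> x)"
  by (auto simp: bilinear_def linear_iff \<Gamma>_def vec_eq_iff sum.distrib[symmetric] sum_distrib_left algebra_simps)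

lemmas \<Gamma>_simps =
  bilinear_ladd[OF bilinear_\<Gamma>] bilinear_radd[OF bilinear_\<Gamma>]
  bilinear_lmul[OF bilinear_\<Gamma>] bilinear_rmul[OF bilinear_\<Gamma>]

lemma \<Gamma>_differentiable:
  assumes x: "x \<in> D" shows "(\<lambda>y. \<Gamma> y v w) differentiable (at x)"
proof -
  have "(\<lambda>y. koszul y v w u) differentiable (at x)" for u
    unfolding koszul_def
    by (intro differentiable_divide differentiable_const differentiable_add differentiable_diff
        dg_differentiable x) simp
  then have "(\<lambda>y. \<Sum>l\<in>UNIV. matrix_inv (local_metric M c y) $ k $ l * koszul y v w (axis l 1))
      differentiable (at x)" for k
    by (intro differentiable_sum ballI differentiable_mult
        differentiable_matrix_inv_entry[OF open_image x] metric_invertible entry_differentiable x)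
      simp_all
  then have "(\<lambda>y. matrix_inv (local_metric M c y) *v (\<chi> l. koszul y v w (axis l 1)))
      differentiable (at x)"
    by (intro differentiable_vec_lambda) (simp add: matrix_vector_mult_def)
  then show ?thesis
    using has_derivative_transform_within_open[OF _ open_image x] \<Gamma>_eq
    unfolding differentiable_def by (metis (no_types, lifting))
qed

text \<open>\<open>d\<Gamma> x u v w\<close> is the derivative at \<open>x\<close> in the direction \<open>u\<close> of \<open>\<Gamma>(v,w)\<close>, for constant
  \<open>v\<close> and \<open>w\<close>.\<close>

definition d\<Gamma> :: "real ^ 'n \<Rightarrow> real ^ 'n \<Rightarrow> real ^ 'n \<Rightarrow> real ^ 'n \<Rightarrow> real ^ 'n" where
  "d\<Gamma> x u v w = frechet_derivative (\<lambda>y. \<Gamma> y v w) (at x) u"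

lemma d\<Gamma>_sym: "x \<in> D \<Longrightarrow> d\<Gamma> x u v w = d\<Gamma> x u w v"
  unfolding d\<Gamma>_def
  by (rule fun_cong, rule frechet_derivative_transform_within_open[OF \<Gamma>_differentiable open_image])
     (auto simp: \<Gamma>_sym)

lemma d\<Gamma>_linear:
  assumes x: "x \<in> D"
  shows "linear (\<lambda>u. d\<Gamma> x u v w)" "linear (\<lambda>v. d\<Gamma> x u v w)" "linear (d\<Gamma> x u v)"
proof -
  have h: "((\<lambda>y. \<Gamma> y v w) has_derivative (\<lambda>u. d\<Gamma> x u v w)) (at x)" for v w
    using \<Gamma>_differentiable[OF x] unfolding d\<Gamma>_def by (simp add: frechet_derivative_works)
  then show "linear (\<lambda>u. d\<Gamma> x u v w)" by (rule has_derivative_linear)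
  \<comment> \<open>Linearity in \<open>w\<close> is inherited from \<open>\<Gamma>\<close> by uniqueness of the derivative.\<close>
  have add: "d\<Gamma> x u v (w + w') = d\<Gamma> x u v w + d\<Gamma> x u v w'" for v w w'
    using fun_cong[OF has_derivative_unique[OF h[of v "w + w'"]
      has_derivative_add[OF h[of v w] h[of v w'], folded \<Gamma>_simps(2)]]] .
  have scale: "d\<Gamma> x u v (r *\<^sub>R w) = r *\<^sub>R d\<Gamma> x u v w" for v w r
    using fun_cong[OF has_derivative_unique[OF h[of v "r *\<^sub>R w"]
      has_derivative_scaleR_right[OF h[of v w], of r, folded \<Gamma>_simps(4)]]] .
  show "linear (d\<Gamma> x u v)" using add scale by (simp add: linear_iff)
  then show "linear (\<lambda>v. d\<Gamma> x u v w)"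
    using add scale by (simp add: linear_iff d\<Gamma>_sym[OF x, of _ _ w])
qed

text \<open>The curvature of constant fields at a point of the chart.\<close>

definition R :: "real ^ 'n \<Rightarrow> real ^ 'n \<Rightarrow> real ^ 'n \<Rightarrow> real ^ 'n \<Rightarrow> real ^ 'n" where
  "R x u v w = local_curvature M c (\<lambda>_. u) (\<lambda>_. v) (\<lambda>_. w) x"

lemma R_eq: "R x u v w = d\<Gamma> x u v w - d\<Gamma> x v u w + \<Gamma> x u (\<Gamma> x v w) - \<Gamma> x v (\<Gamma> x u w)"
proof -
  have lc: "levi_civita M c V W x = frechet_derivative W (at x) (V x) + \<Gamma> x (V x) (W x)" for V W x
    by (simp add: levi_civita_def \<Gamma>_def)
  have const: "levi_civita M c (\<lambda>_. u) (\<lambda>_. v) = (\<lambda>y. \<Gamma> y u v)" for u v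
    by (rule ext) (simp add: lc)
  have "lie_bracket (\<lambda>_. u) (\<lambda>_. v) = (\<lambda>_. 0)"
    by (rule ext) (simp add: lie_bracket_def)
  then show ?thesis
    using bilinear_lzero[OF bilinear_\<Gamma>]
    by (simp add: R_def local_curvature_def const) (simp add: lc d\<Gamma>_def)
qed

lemma R_antisym: "R x u v w = - R x v u w"
  by (simp add: R_eq)

lemma R_linear:
  assumes "x \<in> D"
  shows "linear (\<lambda>u. R x u v w)" "linear (\<lambda>v. R x u v w)" "linear (R x u v)"
  using d\<Gamma>_linear[OF assms, unfolded linear_iff]
  by (auto simp: linear_iff R_eq \<Gamma>_simps algebra_simps)

lemma R_bianchi:
  assumes "x \<in> D" shows "R x u v w + R x v w u + R x w u v = 0"
  using assms by (simp add: R_eq d\<Gamma>_sym[of x _ v u] d\<Gamma>_sym[of x _ w u] d\<Gamma>_sym[of x _ w v]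
      \<Gamma>_sym[of x v u] \<Gamma>_sym[of x w u] \<Gamma>_sym[of x w v])

text \<open>Differentiating metric compatibility once more expresses the second derivatives of
  \<open>g(w,z)\<close>; the terms left after antisymmetrising in the two directions are those of \<open>R\<close>.\<close>

lemma R_skew:
  assumes x: "x \<in> D" shows "g x (R x u v w) z = - g x w (R x u v z)"
proof -
  have second: "frechet_derivative (\<lambda>y. dg y v w z) (at x) u =
      g x (d\<Gamma> x u v w) z + g x (\<Gamma> x u (\<Gamma> x v w)) z + g x (\<Gamma> x v w) (\<Gamma> x u z)
    + g x (d\<Gamma> x u v z) w + g x (\<Gamma> x u (\<Gamma> x v z)) w + g x (\<Gamma> x v z) (\<Gamma> x u w)" for u v
  proof -
    have diff: "(\<lambda>y. g y (\<Gamma> y v w) z) differentiable (at x)" for w z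
      using g_has_derivative[OF x] \<Gamma>_differentiable[OF x] unfolding differentiable_def by blast
    have "frechet_derivative (\<lambda>y. dg y v w z) (at x) u =
        frechet_derivative (\<lambda>y. g y (\<Gamma> y v w) z + g y (\<Gamma> y v z) w) (at x) u"
      by (subst frechet_derivative_transform_within_open[OF dg_differentiable open_image, of x _ _ _
            "\<lambda>y. g y (\<Gamma> y v w) z + g y (\<Gamma> y v z) w"])
        (auto simp: x metric_compatible g_sym[of _ w])
    also have "\<dots> = frechet_derivative (\<lambda>y. g y (\<Gamma> y v w) z) (at x) u
        + frechet_derivative (\<lambda>y. g y (\<Gamma> y v z) w) (at x) u"
      using frechet_derivative_at[OF has_derivative_add[OF diff[of w z, unfolded frechet_derivative_works]
            diff[of z w, unfolded frechet_derivative_works]], symmetric]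
      by simp
    also have "\<dots> = g x (d\<Gamma> x u v w) z + dg x u (\<Gamma> x v w) z + (g x (d\<Gamma> x u v z) w + dg x u (\<Gamma> x v z) w)"
      by (simp add: g_derivative[OF x \<Gamma>_differentiable[OF x]] d\<Gamma>_def)
    finally show ?thesis by (simp add: metric_compatible[OF x])
  qed
  have "frechet_derivative (\<lambda>y. dg y v w z) (at x) u = frechet_derivative (\<lambda>y. dg y u w z) (at x) v"
    by (rule dg_derivatives_commute[OF x])
  then show ?thesis
    unfolding second
    by (simp add: R_eq g_simps g_sym[OF x, of w] g_sym[OF x, of "\<Gamma> x u w"] g_sym[OF x, of "\<Gamma> x u z"])
qed

end


section \<open>Changes of coordinates\<close>

lemma chart_inv_map: "is_chart c \<Longrightarrow> p \<in> chart_dom c \<Longrightarrow> chart_inv c (chart_map c p) = p"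
  unfolding is_chart_def by (meson homeomorphism_apply1)

lemma chart_map_inv: "is_chart c \<Longrightarrow> x \<in> chart_image c \<Longrightarrow> chart_map c (chart_inv c x) = x"
  unfolding is_chart_def by (meson homeomorphism_apply2)

lemma chart_inv_in_dom: "is_chart c \<Longrightarrow> x \<in> chart_image c \<Longrightarrow> chart_inv c x \<in> chart_dom c"
  unfolding is_chart_def homeomorphism_def by blast

lemma open_chart_overlap:
  assumes "is_chart c" "is_chart d"
  shows "open (chart_map c ` (chart_dom c \<inter> chart_dom d))"
proof -
  have "openin (top_of_set (chart_dom c)) (chart_dom c \<inter> chart_dom d)"
    using assms by (simp add: is_chart_def openin_open_Int)
  then have "openin (top_of_set (chart_image c)) (chart_map c ` (chart_dom c \<inter> chart_dom d))"
    using assms homeomorphism_imp_open_map unfolding is_chart_def by blast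
  then show ?thesis
    using assms openin_open_trans unfolding is_chart_def by blast
qed

context
  fixes M :: "('m::{t2_space,second_countable_topology}, 'n::finite, 'z) metric_manifold_scheme"
  assumes M: "smooth_manifold M"
begin

lemma chart_of_atlas: "c \<in> atlas M \<Longrightarrow> is_chart c"
  using M by (simp add: smooth_manifold_def)

lemma transition_differentiable:
  assumes "c \<in> atlas M" "d \<in> atlas M" "p \<in> chart_dom c" "p \<in> chart_dom d"
  shows "(chart_map d \<circ> chart_inv c) differentiable (at (chart_map c p))"
proof -
  have "Ck_on (Suc 0) (chart_map c ` (chart_dom c \<inter> chart_dom d)) (chart_map d \<circ> chart_inv c)"
    using M assms unfolding smooth_manifold_def smooth_on_def by blast
  then show ?thesis using assms by simp
qed

lemma linear_coord_change:
  assumes "c \<in> atlas M" "d \<in> atlas M" "p \<in> chart_dom c" "p \<in> chart_dom d"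
  shows "linear (coord_change c d p)"
  unfolding coord_change_def
  using linear_frechet_derivative[OF transition_differentiable[OF assms]] by (simp add: eta_contract_eq)

lemma coord_change_inverse:
  assumes "c \<in> atlas M" "d \<in> atlas M" "p \<in> chart_dom c" "p \<in> chart_dom d"
  shows "coord_change d c p (coord_change c d p v) = v"
proof -
  let ?W = "chart_map c ` (chart_dom c \<inter> chart_dom d)"
  let ?f = "chart_map d \<circ> chart_inv c" and ?h = "chart_map c \<circ> chart_inv d"
  note inv = chart_inv_map[OF chart_of_atlas[OF assms(1)]] chart_inv_map[OF chart_of_atlas[OF assms(2)]]
  have fp: "?f (chart_map c p) = chart_map d p"
    using inv assms by simp
  have f: "?f differentiable (at (chart_map c p))"
    using assms by (rule transition_differentiable)
  have h: "?h differentiable (at (?f (chart_map c p)))"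
    unfolding fp using assms by (intro transition_differentiable)
  have eq: "frechet_derivative (\<lambda>x. x) (at (chart_map c p)) = frechet_derivative (?h \<circ> ?f) (at (chart_map c p))"
    by (rule frechet_derivative_transform_within_open[of _ _ ?W])
       (use assms inv in \<open>auto intro!: open_chart_overlap chart_of_atlas\<close>)
  have "frechet_derivative ?h (at (?f (chart_map c p))) (frechet_derivative ?f (at (chart_map c p)) v) = v"
    using fun_cong[OF eq, of v] unfolding frechet_derivative_compose[OF f h] frechet_derivative_ident
    by (simp only: o_apply)
  then show ?thesis
    unfolding coord_change_def fp .
qed

lemma coord_change_self:
  assumes "c \<in> atlas M" "p \<in> chart_dom c"
  shows "coord_change c c p v = v"
proof -
  have c: "is_chart c" using assms chart_of_atlas by blast
  have eq: "frechet_derivative (\<lambda>x. x) (at (chart_map c p)) =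
      frechet_derivative (chart_map c \<circ> chart_inv c) (at (chart_map c p))"
    by (rule frechet_derivative_transform_within_open[of _ _ "chart_image c"])
       (use c chart_map_inv[OF c] assms in \<open>auto simp: is_chart_def chart_image_def\<close>)
  show ?thesis
    using fun_cong[OF eq, of v] unfolding coord_change_def frechet_derivative_ident by (rule sym)
qed

end

text \<open>The coordinate metric in \<open>c\<close> is the pullback of the metric at \<open>p\<close> along the change to the
  preferred chart at \<open>p\<close>.\<close>

lemma local_metric_form:
  assumes M: "semi_riemannian_manifold M" and c: "c \<in> atlas M" and p: "p \<in> chart_dom c"
  defines "J \<equiv> coord_change c (chart_at M p) p"
  shows "v \<bullet> (local_metric M c (chart_map c p) *v w) = metric_at M p (J v) (J w)"
proof -
  have sm: "smooth_manifold M" using M by (simp add: semi_riemannian_manifold_def)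
  have J: "linear J"
    unfolding J_def using sm c p by (intro linear_coord_change) (auto simp: smooth_manifold_def)
  have b: "bilinear (metric_at M p)"
    using M by (simp add: semi_riemannian_manifold_def)
  have "bilinear (\<lambda>v w. metric_at M p (J v) (J w))"
    using b J by (auto simp: bilinear_def linear_iff)
  from bilinear_axis_expansion[OF this, of v w] show ?thesis
    using chart_inv_map[OF chart_of_atlas[OF sm c] p]
    by (simp add: local_metric_def Let_def J_def inner_vec_def matrix_vector_mult_def
        sum_distrib_left mult_ac)
qed

text \<open>Invertibility of the coordinate metric holds because the metric is nondegenerate at every
  point and changes of coordinates are bijective on tangent vectors.\<close>

lemma coordinate_metric_chart:
  assumes M: "semi_riemannian_manifold M" and c: "c \<in> atlas M"
  shows "coordinate_metric M c"
proof
  have sm: "smooth_manifold M" using M by (simp add: semi_riemannian_manifold_def)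
  have ch: "is_chart c" by (rule chart_of_atlas[OF sm c])
  show "open (chart_image c)" using ch by (simp add: is_chart_def)
  show "smooth_on (chart_image c) (\<lambda>x. local_metric M c x $ i $ j)" for i j
    using M c by (simp add: semi_riemannian_manifold_def)
  fix x assume x: "x \<in> chart_image c"
  show "local_metric M c x $ i $ j = local_metric M c x $ j $ i" for i j
    using M by (simp add: local_metric_def Let_def semi_riemannian_manifold_def)
  define p where "p = chart_inv c x"
  define d where "d = chart_at M p"
  have p: "p \<in> chart_dom c" unfolding p_def by (rule chart_inv_in_dom[OF ch x])
  have xp: "chart_map c p = x" unfolding p_def by (rule chart_map_inv[OF ch x])
  have d: "d \<in> atlas M" "p \<in> chart_dom d"
    unfolding d_def using sm by (auto simp: smooth_manifold_def)
  let ?J = "coord_change c d p" and ?K = "coord_change d c p"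
  have "w = 0" if "local_metric M c x *v w = 0" for w
  proof -
    have "metric_at M p (?J w) u = 0" for u
    proof -
      have "metric_at M p (?J (?K u)) (?J w) = ?K u \<bullet> (local_metric M c x *v w)"
        using local_metric_form[OF M c p, of "?K u" w] by (simp add: xp d_def)
      then have "metric_at M p u (?J w) = 0"
        using that coord_change_inverse[OF sm d(1) c d(2) p] by simp
      then show ?thesis using M by (simp add: semi_riemannian_manifold_def)
    qed
    then have "?J w = 0"
      using M unfolding semi_riemannian_manifold_def by blast
    then show ?thesis
      using coord_change_inverse[OF sm c d(1) p d(2), of w]
        linear_0[OF linear_coord_change[OF sm d(1) c d(2) p]] by simp
  qed
  then show "invertible (local_metric M c x)"
    by (simp add: invertible_left_inverse matrix_left_invertible_ker)
qed


section \<open>The curvature tensor at a point\<close>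

context
  fixes M :: "('m::{t2_space,second_countable_topology}, 'n::finite, 'z) metric_manifold_scheme"
    and p :: 'm
  assumes M: "semi_riemannian_manifold M"
begin

lemma bilinear_metric: "bilinear (metric_at M p)"
  using M by (simp add: semi_riemannian_manifold_def)

lemma metric_sym: "metric_at M p v w = metric_at M p w v"
  using M by (simp add: semi_riemannian_manifold_def)

lemma metric_nondegenerate: "(\<And>w. metric_at M p v w = 0) \<Longrightarrow> v = 0"
  using M unfolding semi_riemannian_manifold_def by blast

lemma preferred_chart:
  "chart_at M p \<in> atlas M" "p \<in> chart_dom (chart_at M p)" "chart_map (chart_at M p) p \<in> chart_image (chart_at M p)"
  using M by (auto simp: semi_riemannian_manifold_def smooth_manifold_def chart_image_def)

interpretation C: coordinate_metric M "chart_at M p"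
  by (rule coordinate_metric_chart[OF M preferred_chart(1)])

lemma curvature_eq: "curvature M p x y z = C.R (chart_map (chart_at M p) p) x y z"
  by (simp add: curvature_def C.R_def Let_def)

text \<open>In the preferred chart at \<open>p\<close> no change of components occurs at \<open>p\<close> itself.\<close>

lemma metric_eq: "metric_at M p v w = C.g (chart_map (chart_at M p) p) v w"
  using local_metric_form[OF M preferred_chart(1,2), of v w] coord_change_self[OF _ preferred_chart(1,2)] M
  by (simp add: C.g_def semi_riemannian_manifold_def)

lemma curvature_antisym: "curvature M p x y z = - curvature M p y x z"
  unfolding curvature_eq by (rule C.R_antisym)

lemma curvature_bianchi: "curvature M p x y z + curvature M p y z x + curvature M p z x y = 0"
  unfolding curvature_eq by (rule C.R_bianchi[OF preferred_chart(3)])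

lemma curvature_skew: "metric_at M p (curvature M p x y z) w = - metric_at M p z (curvature M p x y w)"
  unfolding curvature_eq metric_eq by (rule C.R_skew[OF preferred_chart(3)])

lemma curvature_linear:
  "linear (\<lambda>x. curvature M p x y z)" "linear (\<lambda>y. curvature M p x y z)" "linear (curvature M p x y)"
  using C.R_linear[OF preferred_chart(3)] unfolding curvature_eq[abs_def] by auto

end


section \<open>The Ricci tensor\<close>

text \<open>For a nondegenerate form \<open>b\<close> with Gram matrix \<open>B\<close>, and \<open>A\<close> the matrix of \<open>L\<close>, skewness
  says that the transpose of \<open>A\<close> is \<open>- B A B\<^sup>-\<^sup>1\<close>, so \<open>trace A = - trace A\<close>.\<close>

lemma trace_skew_eq_0:
  fixes b :: "real ^ 'n::finite \<Rightarrow> real ^ 'n \<Rightarrow> real"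
  assumes b: "bilinear b" and nondeg: "\<And>v. (\<And>w. b w v = 0) \<Longrightarrow> v = 0"
    and L: "linear L" and skew: "\<And>x y. b (L x) y = - b x (L y)"
  shows "trace (matrix L) = 0"
proof -
  define A where "A = matrix L"
  define B where "B = (\<chi> i j. b (axis i 1) (axis j 1))"
  have bB: "b v w = v \<bullet> (B *v w)" for v w
    using bilinear_axis_expansion[OF b, of v w]
    by (simp add: B_def inner_vec_def matrix_vector_mult_def sum_distrib_left mult_ac)
  have LA: "L x = A *v x" for x
    unfolding A_def using matrix_works L linear_matrix_vector_mul_eq by metis
  have "B *v w = 0 \<Longrightarrow> w = 0" for w
    by (rule nondeg) (simp add: bB)
  then have "invertible B"
    by (simp add: invertible_left_inverse matrix_left_invertible_ker)
  note inv = matrix_inv_mult[OF this]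
  have "x \<bullet> ((transpose A ** B) *v y) = x \<bullet> (- (B ** A) *v y)" for x y
  proof -
    have "(A *v x) \<bullet> w = x \<bullet> (transpose A *v w)" for w
      by (metis dot_lmul_matrix transpose_matrix_vector transpose_transpose)
    moreover have "- (B ** A) *v y = - ((B ** A) *v y)"
      by (simp add: vec_eq_iff matrix_vector_mult_def sum_negf)
    ultimately show ?thesis
      using skew[of x y] unfolding bB LA
      by (simp add: matrix_vector_mul_assoc del: transpose_matrix_vector)
  qed
  then have "(transpose A ** B) *v y = - (B ** A) *v y" for y
    by (subst vector_eq_ldot[symmetric]) blast
  then have AB: "transpose A ** B = - (B ** A)"
    by (subst matrix_eq) blast
  have "transpose A = (transpose A ** B) ** matrix_inv B"
    using inv by (simp add: matrix_mul_assoc[symmetric])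
  then have "trace (transpose A) = trace (- (B ** A) ** matrix_inv B)" unfolding AB by simp
  also have "\<dots> = trace (matrix_inv B ** - (B ** A))" by (rule trace_mul_sym)
  also have "matrix_inv B ** - (B ** A) = - A"
  proof -
    have "matrix_inv B ** - (B ** A) = - (matrix_inv B ** (B ** A))"
      by (simp add: vec_eq_iff matrix_matrix_mult_def sum_negf)
    then show ?thesis using inv by (simp add: matrix_mul_assoc)
  qed
  finally have "trace (transpose A) = - trace A" by (simp add: trace_def sum_negf)
  moreover have "trace (transpose A) = trace A" by (simp add: trace_def transpose_def)
  ultimately show ?thesis by (simp add: A_def)
qed

lemma nondegenerate_form_represents:
  fixes b :: "real ^ 'n::finite \<Rightarrow> real ^ 'n \<Rightarrow> real"
  assumes b: "bilinear b" and nondeg: "\<And>v. (\<And>w. b v w = 0) \<Longrightarrow> v = 0" and h: "linear h"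
  shows "\<exists>!v. \<forall>y. b v y = h y"
proof -
  define F where "F v = (\<chi> j. b v (axis j 1))" for v
  have lin: "linear F"
    using b by (auto simp: F_def linear_iff vec_eq_iff bilinear_def)
  have b_lin: "linear (b v)" for v using b by (simp add: bilinear_def)
  have F: "F v = (\<chi> j. f (axis j 1)) \<longleftrightarrow> (\<forall>y. b v y = f y)" if "linear f" for v f
  proof
    assume "F v = (\<chi> j. f (axis j 1))"
    then have j: "b v (axis j 1) = f (axis j 1)" for j by (simp add: F_def vec_eq_iff)
    show "\<forall>y. b v y = f y"
    proof
      fix y
      show "b v y = f y"
        unfolding linear_axis_expansion[OF b_lin, of v y] linear_axis_expansion[OF that, of y] j ..
    qed
  qed (simp add: F_def)
  have "v = 0" if "F v = 0" for v
    using F[of "\<lambda>_. 0" v] that nondeg by (simp add: zero_vec_def linear_zero)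
  then have "inj F" using lin by (simp add: linear_injective_0)
  moreover from this have "surj F" using lin linear_injective_imp_surjective by blast
  ultimately have "\<exists>!v. F v = (\<chi> j. h (axis j 1))"
    by (metis injD surj_def)
  then show ?thesis using F[OF h] by simp
qed

context
  fixes M :: "('m::{t2_space,second_countable_topology}, 'n::finite, 'z) metric_manifold_scheme"
    and p :: 'm
  assumes M: "semi_riemannian_manifold M"
begin

lemma ricci_sum: "ricci M p y z = (\<Sum>i\<in>UNIV. curvature M p (axis i 1) y z $ i)"
  by (simp add: ricci_def trace_def matrix_def)

lemma bilinear_ricci: "bilinear (ricci M p)"
  using curvature_linear[OF M, of p]
  by (auto simp: bilinear_def linear_iff ricci_sum sum.distrib sum_distrib_left)

text \<open>By the Bianchi identity the difference of the two sides is minus the trace of \<open>R(y,z)\<close>,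
  which is skew with respect to the metric.\<close>

lemma ricci_sym: "ricci M p y z = ricci M p z y"
proof -
  have diff: "curvature M p x y z - curvature M p x z y = - curvature M p y z x" for x
    using curvature_bianchi[OF M, of p x y z] curvature_antisym[OF M, of p z x y]
    by (simp add: algebra_simps eq_neg_iff_add_eq_0)
  have "ricci M p y z - ricci M p z y =
      (\<Sum>i\<in>UNIV. (curvature M p (axis i 1) y z - curvature M p (axis i 1) z y) $ i)"
    by (simp add: ricci_sum sum_subtractf)
  also have "\<dots> = - trace (matrix (curvature M p y z))"
    unfolding diff by (simp add: trace_def matrix_def sum_negf)
  also have "trace (matrix (curvature M p y z)) = 0"
  proof (rule trace_skew_eq_0)
    show "bilinear (metric_at M p)" by (rule bilinear_metric[OF M])
    show "linear (curvature M p y z)" by (rule curvature_linear(3)[OF M])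
    show "metric_at M p (curvature M p y z v) w = - metric_at M p v (curvature M p y z w)" for v w
      by (rule curvature_skew[OF M])
    show "v = 0" if "\<And>w. metric_at M p w v = 0" for v
      by (rule metric_nondegenerate[OF M, where p = p]) (simp add: metric_sym[OF M, of p v] that)
  qed
  finally show ?thesis by simp
qed

lemma metric_ricci_op: "metric_at M p (ricci_op M p x) y = ricci M p x y"
proof -
  have "linear (ricci M p x)" using bilinear_ricci by (simp add: bilinear_def)
  moreover have "v = 0" if "\<And>w. metric_at M p v w = 0" for v
    using that by (rule metric_nondegenerate[OF M, where p = p])
  ultimately have "\<exists>!v. \<forall>y. metric_at M p v y = ricci M p x y"
    using nondegenerate_form_represents[OF bilinear_metric[OF M, of p]] by blast
  from theI'[OF this]
  show ?thesis unfolding ricci_op_def by blast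
qed

text \<open>The trace of \<open>x \<mapsto> k (g(y,z) x - g(x,z) y)\<close> is \<open>k (n g(y,z) - g(y,z))\<close>.\<close>

lemma ricci_nullity:
  assumes "z \<in> nullity M k p"
  shows "ricci M p y z = k * (real CARD('n) - 1) * metric_at M p y z"
proof -
  have "linear (\<lambda>y. metric_at M p y z)"
    using bilinear_metric[OF M] by (simp add: bilinear_def)
  from linear_axis_expansion[OF this, of y]
  have e: "(\<Sum>i\<in>UNIV. y $ i * metric_at M p (axis i 1) z) = metric_at M p y z"
    by simp
  have "ricci M p y z =
      (\<Sum>i\<in>UNIV. k * metric_at M p y z - k * (metric_at M p (axis i 1) z * y $ i))"
  proof -
    have "curvature M p v y z = k *\<^sub>R (metric_at M p y z *\<^sub>R v - metric_at M p v z *\<^sub>R y)" for v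
      using assms by (simp add: nullity_def)
    then show ?thesis by (simp add: ricci_sum right_diff_distrib)
  qed
  also have "\<dots> = k * (real CARD('n) - 1) * metric_at M p y z"
    by (simp add: sum_subtractf sum_distrib_left[symmetric] e algebra_simps)
  finally show ?thesis .
qed

end

section \<open>Semisymmetry evaluated on the characteristic vector field\<close>

lemma T_semisymmetric_identity:
  fixes M :: "('m::{t2_space,second_countable_topology}, 'n::finite, 'z) metric_manifold_scheme"
    and a b :: "nat \<Rightarrow> real" and p :: 'm
  defines "n \<equiv> real CARD('n)" and "r \<equiv> scalar_curvature M p"
  defines "B \<equiv> b 0 + n * b 1 + b 2 + b 3 + b 5 + b 6" and "C \<equiv> b 4 * r + (n - 1) * b 7 * r"
  assumes N: "Nk_semi_riemannian_manifold M k \<xi> \<epsilon>" and T: "T_semisymmetric M a b"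
    and Y: "vector_field M Y" and U: "vector_field M U"
  shows "0 = \<epsilon> * a 5 * B * ricci_sq M p (Y p) (U p)
    + (\<epsilon> * B * (- k * a 0 + k * (n - 1) * a 1 + k * (n - 1) * a 2 - a 7 * r)
        + \<epsilon> * (a 1 + a 5) * C) * ricci M p (Y p) (U p)
    + (\<epsilon> * k * (n - 1) * (a 2 + a 4) * C
        + \<epsilon> * k * (n - 1) * B * (k * a 0 + k * (n - 1) * a 4 + a 7 * r)) * metric_at M p (Y p) (U p)
    + k * (n - 1) * (a 1 + a 2 + 2 * a 3 + a 4 + a 5 + 2 * a 6) * (C + k * (n - 1) * B)
        * eta_form M \<xi> \<epsilon> p (Y p) * eta_form M \<xi> \<epsilon> p (U p)"
proof -
  have M: "semi_riemannian_manifold M" and \<xi>: "vector_field M \<xi>" and \<epsilon>: "\<epsilon> = 1 \<or> \<epsilon> = - 1"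
    and unit: "metric_at M p (\<xi> p) (\<xi> p) = \<epsilon>" and null: "\<xi> p \<in> nullity M k p"
    using N by (auto simp: Nk_semi_riemannian_manifold_def)
  define g where "g = metric_at M p"
  define S where "S = ricci M p"
  define Q where "Q = ricci_op M p"
  define \<kappa> where "\<kappa> = k * (n - 1)"
  define x where "x = \<xi> p"
  define y where "y = Y p"
  define u where "u = U p"
  define t where "t = g y u"
  define s where "s = S y u"
  define \<alpha> where "\<alpha> = g y x"
  define \<beta> where "\<beta> = g u x"
  have bil: "bilinear g" "bilinear S"
    unfolding g_def S_def by (rule bilinear_metric[OF M] bilinear_ricci[OF M])+
  note lin = bilinear_ladd[OF bil(1)] bilinear_radd[OF bil(1)] bilinear_lsub[OF bil(1)]
    bilinear_rsub[OF bil(1)] bilinear_lmul[OF bil(1)] bilinear_rmul[OF bil(1)]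
    bilinear_ladd[OF bil(2)] bilinear_radd[OF bil(2)] bilinear_lsub[OF bil(2)]
    bilinear_rsub[OF bil(2)] bilinear_lmul[OF bil(2)] bilinear_rmul[OF bil(2)]
  have g_sym: "g v w = g w v" for v w unfolding g_def by (rule metric_sym[OF M])
  have S_sym: "S v w = S w v" for v w unfolding S_def by (rule ricci_sym[OF M])
  have gQ: "g (Q v) w = S v w" for v w unfolding g_def Q_def S_def by (rule metric_ricci_op[OF M])
  have gQ': "g v (Q w) = S w v" for v w using g_sym gQ by metis
  have Sx: "S v x = \<kappa> * g v x" for v
    unfolding S_def x_def g_def \<kappa>_def n_def by (rule ricci_nullity[OF M null])
  have xS: "S x v = \<kappa> * g v x" for v using Sx S_sym by metis
  have xx: "g x x = \<epsilon>" using unit by (simp add: g_def x_def)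
  have Rx: "curvature M p x y x = k *\<^sub>R (g y x *\<^sub>R x - g x x *\<^sub>R y)"
    using null by (simp add: nullity_def x_def g_def)
  have gR: "g (curvature M p x y u) x = - (k * (\<alpha> * \<beta> - \<epsilon> * t))"
  proof -
    have "g (curvature M p x y u) x = - g u (curvature M p x y x)"
      unfolding g_def by (rule curvature_skew[OF M])
    then show ?thesis
      unfolding Rx by (simp add: lin xx \<alpha>_def \<beta>_def t_def g_sym[of u y])
  qed
  have abbr: "g y u = t" "g u y = t" "g x y = \<alpha>" "g y x = \<alpha>" "g x u = \<beta>" "g u x = \<beta>"
    "S y u = s" "S u y = s"
    unfolding t_def s_def \<alpha>_def \<beta>_def by (auto intro: g_sym S_sym)
  have T_eq: "T_curvature M a p v w z = a 0 *\<^sub>R curvature M p v w z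
      + (a 1 * S w z) *\<^sub>R v + (a 2 * S v z) *\<^sub>R w + (a 3 * S v w) *\<^sub>R z
      + (a 4 * g w z) *\<^sub>R Q v + (a 5 * g v z) *\<^sub>R Q w + (a 6 * g v w) *\<^sub>R Q z
      + (a 7 * r) *\<^sub>R (g w z *\<^sub>R v - g v z *\<^sub>R w)" for v w z
    by (simp add: T_curvature_def Let_def g_def S_def Q_def r_def)
  have Tb: "T_ricci M b p v w = B * S v w + C * g v w" for v w
    by (simp add: T_ricci_def Let_def B_def C_def S_def g_def n_def r_def algebra_simps)
  have first: "g (T_curvature M a p x y u) x = - a 0 * (k * (\<alpha> * \<beta> - \<epsilon> * t)) + \<epsilon> * a 1 * s
      + (a 2 + a 3 + a 5 + a 6) * \<kappa> * \<alpha> * \<beta> + a 4 * \<kappa> * \<epsilon> * t + a 7 * r * (\<epsilon> * t - \<alpha> * \<beta>)"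
    unfolding T_eq by (simp add: lin gR gQ Sx xS abbr xx) (simp add: algebra_simps)
  have second: "g u (T_curvature M a p x y x) = a 0 * k * (\<alpha> * \<beta> - \<epsilon> * t)
      + (a 1 + a 3 + a 4 + a 6) * \<kappa> * \<alpha> * \<beta> + a 2 * \<kappa> * \<epsilon> * t + a 5 * \<epsilon> * s
      + a 7 * r * (\<alpha> * \<beta> - \<epsilon> * t)"
    unfolding T_eq Rx by (simp add: lin gQ' Sx xS abbr xx) (simp add: algebra_simps)
  have SQ: "S u (Q y) = ricci_sq M p y u"
    unfolding ricci_sq_def S_def[symmetric] Q_def[symmetric] by (rule S_sym)
  have SQx: "S u (Q x) = \<kappa> * \<kappa> * \<beta>"
  proof -
    have "S u (Q x) = S x (Q u)" using gQ[of u "Q x"] gQ'[of "Q u" x] by simp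
    also have "\<dots> = \<kappa> * S u x" unfolding xS gQ ..
    finally show ?thesis by (simp add: Sx abbr)
  qed
  have third: "S u (T_curvature M a p x y x) = a 0 * k * (\<kappa> * \<alpha> * \<beta> - \<epsilon> * s)
      + (a 1 + a 3 + a 4 + a 6) * \<kappa> * \<kappa> * \<alpha> * \<beta> + a 2 * \<kappa> * \<epsilon> * s + a 5 * \<epsilon> * ricci_sq M p y u
      + a 7 * r * (\<kappa> * \<alpha> * \<beta> - \<epsilon> * s)"
    unfolding T_eq Rx by (simp add: lin SQ SQx Sx xS abbr xx) (simp add: algebra_simps)
  \<comment> \<open>The condition is used with \<open>X = V = \<xi>\<close>.\<close>
  have "T_ricci M b p (T_curvature M a p x y u) x + T_ricci M b p u (T_curvature M a p x y x) = 0"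
    using T \<xi> Y U unfolding T_semisymmetric_def x_def y_def u_def by blast
  then have sum: "(B * \<kappa> + C) * g (T_curvature M a p x y u) x
      + B * S u (T_curvature M a p x y x) + C * g u (T_curvature M a p x y x) = 0"
    unfolding Tb Sx by (simp add: algebra_simps)
  have main: "0 = \<epsilon> * a 5 * B * ricci_sq M p y u
    + (\<epsilon> * B * (- k * a 0 + \<kappa> * a 1 + \<kappa> * a 2 - a 7 * r) + \<epsilon> * (a 1 + a 5) * C) * s
    + (\<epsilon> * \<kappa> * (a 2 + a 4) * C + \<epsilon> * \<kappa> * B * (k * a 0 + \<kappa> * a 4 + a 7 * r)) * t
    + \<kappa> * (a 1 + a 2 + 2 * a 3 + a 4 + a 5 + 2 * a 6) * (C + \<kappa> * B) * (\<alpha> * \<beta>)"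
    by (rule trans[OF sum[symmetric, unfolded first second third]]) algebra
  \<comment> \<open>The two signs in \<open>\<eta>\<close> cancel because \<open>\<epsilon>\<^sup>2 = 1\<close>.\<close>
  have eta: "eta_form M \<xi> \<epsilon> p y * eta_form M \<xi> \<epsilon> p u = \<alpha> * \<beta>"
    using \<epsilon> unfolding eta_form_def g_def[symmetric] x_def[symmetric] abbr by auto
  show ?thesis
    using main[folded eta]
    unfolding \<kappa>_def s_def t_def y_def u_def S_def g_def mult.assoc .
qed

theorem lemma7p2:
  fixes M :: "('m::{t2_space,second_countable_topology}, 'n::finite) metric_manifold"
    and \<xi> :: "'m \<Rightarrow> real ^ 'n" and k \<epsilon> :: real and a b :: "nat \<Rightarrow> real"
  assumes "Nk_semi_riemannian_manifold M k \<xi> \<epsilon>"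
  shows "(T_semisymmetric M a b \<longrightarrow>
       (\<forall>Y U. vector_field M Y \<longrightarrow> vector_field M U \<longrightarrow> (\<forall>p.
           (let n = real CARD('n); r = scalar_curvature M p; g = metric_at M p;
                S = ricci M p; S2 = ricci_sq M p; \<eta> = eta_form M \<xi> \<epsilon> p in
            0 = \<epsilon> * a 5 * (b 0 + n * b 1 + b 2 + b 3 + b 5 + b 6) * S2 (Y p) (U p)
              + (\<epsilon> * (b 0 + n * b 1 + b 2 + b 3 + b 5 + b 6)
                     * (- k * a 0 + k * (n - 1) * a 1 + k * (n - 1) * a 2 - a 7 * r)
                 + \<epsilon> * (a 1 + a 5) * (b 4 * r + (n - 1) * b 7 * r)) * S (Y p) (U p)
              + (\<epsilon> * k * (n - 1) * (a 2 + a 4) * (b 4 * r + (n - 1) * b 7 * r)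
                 + \<epsilon> * k * (n - 1) * (b 0 + n * b 1 + b 2 + b 3 + b 5 + b 6)
                     * (k * a 0 + k * (n - 1) * a 4 + a 7 * r)) * g (Y p) (U p)
              + k * (n - 1) * (a 1 + a 2 + 2 * a 3 + a 4 + a 5 + 2 * a 6)
                 * ((b 4 * r + (n - 1) * b 7 * r)
                    + k * (n - 1) * (b 0 + n * b 1 + b 2 + b 3 + b 5 + b 6))
                 * \<eta> (Y p) * \<eta> (U p)))))
     \<and> (T_semisymmetric M a a \<longrightarrow>
       (\<forall>Y U. vector_field M Y \<longrightarrow> vector_field M U \<longrightarrow> (\<forall>p.
           (let n = real CARD('n); r = scalar_curvature M p; g = metric_at M p;
                S = ricci M p; S2 = ricci_sq M p; \<eta> = eta_form M \<xi> \<epsilon> p in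
            0 = \<epsilon> * a 5 * (a 0 + n * a 1 + a 2 + a 3 + a 5 + a 6) * S2 (Y p) (U p)
              + (\<epsilon> * (a 0 + n * a 1 + a 2 + a 3 + a 5 + a 6)
                     * (- k * a 0 + k * (n - 1) * a 1 + k * (n - 1) * a 2 - a 7 * r)
                 + \<epsilon> * (a 1 + a 5) * (a 4 * r + (n - 1) * a 7 * r)) * S (Y p) (U p)
              + (\<epsilon> * k * (n - 1) * (a 2 + a 4) * (a 4 * r + (n - 1) * a 7 * r)
                 + \<epsilon> * k * (n - 1) * (a 0 + n * a 1 + a 2 + a 3 + a 5 + a 6)
                     * (k * a 0 + k * (n - 1) * a 4 + a 7 * r)) * g (Y p) (U p)
              + k * (n - 1) * (a 1 + a 2 + 2 * a 3 + a 4 + a 5 + 2 * a 6)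
                 * ((a 4 * r + (n - 1) * a 7 * r)
                    + k * (n - 1) * (a 0 + n * a 1 + a 2 + a 3 + a 5 + a 6))
                 * \<eta> (Y p) * \<eta> (U p)))))"
  unfolding Let_def
  by (intro conjI impI allI T_semisymmetric_identity[OF assms])

end
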